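(* Let $n\ge 1$, let $A=\{a_1,\dots,a_n\}$ and $S$ the power set of $A$, equipped with the operation $u\rightarrow u' = u\oplus u'$ (symmetric difference). Let $\mathbb{Z}_2^n$ carry coordinatewise addition modulo $2$. Define $f:S\to\mathbb{Z}_2^n$ by $f(u)=(s_1,\dots,s_n)$ with $s_j\equiv\#\{i: a_i\in u,\ i\mid j\}\pmod 2$. Then $f$ is a group isomorphism from $\langle S,\rightarrow\rangle$ to $\langle\mathbb{Z}_2^n,+\rangle$.
   Context: Locker problem: $n$ lockers, students $a_1,\dots,a_n$; starting with all lockers closed, each student $a_i$ in $u$ toggles every locker whose number is a multiple of $i$, and $f(u)$ is the final state ($1$ = open). The operation $\rightarrow$ ("then the next students change the lockers") on subsets of students coincides with symmetric difference, since a student acting twice has no net effect and order does not matter. *)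

theory Defs
  imports "HOL-Algebra.Product_Groups" "HOL-Algebra.Elementary_Groups"
begin

definition sym_diff_group :: "'a set \<Rightarrow> 'a set monoid" where
  "sym_diff_group A = \<lparr>carrier = Pow A, monoid.mult = (\<lambda>u v. sym_diff u v), one = {}\<rparr>"

(* An n-tuple (s_1, ..., s_n) is a function on {1..n}, extended by undefined outside {1..n}. *)
definition Z2_pow :: "nat \<Rightarrow> (nat \<Rightarrow> int) monoid" where
  "Z2_pow n = product_group {1..n} (\<lambda>_. integer_mod_group 2)"

(* s_j is the representative in {0, 1}; the value 1 means that locker j ends up open. *)
definition locker_state :: "nat \<Rightarrow> (nat \<Rightarrow> 'a) \<Rightarrow> 'a set \<Rightarrow> nat \<Rightarrow> int" where
  "locker_state n a u = (\<lambda>j\<in>{1..n}. int (card {i \<in> {1..n}. a i \<in> u \<and> i dvd j}) mod 2)"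

end

theory Submission
  imports Defs
begin

text \<open>Toggling is additive modulo 2, so only bijectivity is at stake. The incidence matrix of
  divisibility is unitriangular: the state of locker \<open>k\<close> is decided by the students \<open>a i\<close> with \<open>i < k\<close>
  together with \<open>a k\<close> itself. Hence the students who acted can be read off one after the other,
  which gives injectivity, and surjectivity follows by counting.\<close>

lemma group_sym_diff_group: "group (sym_diff_group A)"
proof (rule groupI)
  fix x assume "x \<in> carrier (sym_diff_group A)"
  then show "\<exists>y\<in>carrier (sym_diff_group A).
      y \<otimes>\<^bsub>sym_diff_group A\<^esub> x = \<one>\<^bsub>sym_diff_group A\<^esub>"
    \<comment> \<open>Every set is its own inverse, as \<open>sym_diff x x\<close> is empty.\<close>
    by (intro bexI[of _ x]) (auto simp: sym_diff_group_def)
qed (auto simp: sym_diff_group_def)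

text \<open>The common elements \<open>X \<inter> Y\<close> are counted twice in the sum of the
  cardinalities, so they vanish modulo 2.\<close>

lemma card_sym_diff_mod_2:
  assumes "finite X" "finite Y"
  shows "int (card (sym_diff X Y)) mod 2 = (int (card X) mod 2 + int (card Y) mod 2) mod 2"
proof -
  have "card X = card (X - Y) + card (X \<inter> Y)" "card Y = card (Y - X) + card (X \<inter> Y)"
    using assms by (simp_all add: card_Diff_subset_Int Int_commute card_mono)
  moreover have "card (sym_diff X Y) = card (X - Y) + card (Y - X)"
    using assms by (intro card_Un_disjoint) auto
  ultimately have "int (card X) + int (card Y) = int (card (sym_diff X Y)) + 2 * int (card (X \<inter> Y))"
    by simp
  then show ?thesis
    by (metis mod_add_eq mod_mult_self2)
qed

lemma carrier_Z2_pow: "carrier (Z2_pow n) = (\<Pi>\<^sub>E j\<in>{1..n}. {0..<2})"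
  by (simp add: Z2_pow_def carrier_integer_mod_group)

lemma locker_state_hom: "locker_state n a \<in> hom (sym_diff_group A) (Z2_pow n)"
proof (rule homI)
  fix u
  show "locker_state n a u \<in> carrier (Z2_pow n)"
    by (auto simp: carrier_Z2_pow locker_state_def)
next
  fix u v
  have "locker_state n a (sym_diff u v) j = (locker_state n a u j + locker_state n a v j) mod 2"
    if "j \<in> {1..n}" for j
  proof -
    let ?S = "\<lambda>w. {i \<in> {1..n}. a i \<in> w \<and> i dvd j}"
    \<comment> \<open>For a fixed locker \<open>j\<close>, passing to the indices of the students
      who toggle it commutes with symmetric difference; only the parity of cardinalities
      remains.\<close>
    have "?S (sym_diff u v) = sym_diff (?S u) (?S v)"
      by auto
    then show ?thesis
      using that card_sym_diff_mod_2[of "?S u" "?S v"] by (simp add: locker_state_def)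
  qed
  \<comment> \<open>Outside \<open>{1..n}\<close> both functions take the value
    \<open>undefined\<close>.\<close>
  then have "locker_state n a (sym_diff u v)
      = (\<lambda>j\<in>{1..n}. (locker_state n a u j + locker_state n a v j) mod 2)"
    by (auto simp: locker_state_def fun_eq_iff restrict_def)
  then show "locker_state n a (u \<otimes>\<^bsub>sym_diff_group A\<^esub> v)
      = locker_state n a u \<otimes>\<^bsub>Z2_pow n\<^esub> locker_state n a v"
    by (simp add: sym_diff_group_def Z2_pow_def mult_integer_mod_group)
qed

lemma locker_state_eq_imp_mem_iff:
  assumes eq: "locker_state n a u = locker_state n a v" and "k \<in> {1..n}"
  shows "a k \<in> u \<longleftrightarrow> a k \<in> v"
  using \<open>k \<in> {1..n}\<close>
proof (induction k rule: less_induct)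
  case (less k)
  let ?L = "\<lambda>w. {i \<in> {1..<k}. a i \<in> w \<and> i dvd k}"
  have count: "card {i \<in> {1..n}. a i \<in> w \<and> i dvd k} = card (?L w) + of_bool (a k \<in> w)" for w
  proof -
    \<comment> \<open>Divisors of \<open>k\<close> are at most \<open>k\<close>, and
      \<open>k\<close> divides itself, so the only index beyond \<open>?L w\<close> can be
      \<open>k\<close>.\<close>
    have "{i \<in> {1..n}. a i \<in> w \<and> i dvd k} = ?L w \<union> (if a k \<in> w then {k} else {})"
      using less.prems by (auto dest: dvd_imp_le simp: le_less)
    then show ?thesis by simp
  qed
  \<comment> \<open>The induction hypothesis applies to each index below \<open>k\<close>, since all
    of these lie in \<open>{1..n}\<close>.\<close>
  have "?L u = ?L v"
    using less by auto
  moreover have "(int (card (?L u)) + of_bool (a k \<in> u)) mod 2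
      = (int (card (?L v)) + of_bool (a k \<in> v)) mod 2"
    using fun_cong[OF eq, of k] less.prems by (simp only: locker_state_def restrict_apply count) simp
  ultimately show ?case
    by (cases "a k \<in> u"; cases "a k \<in> v"; simp; presburger)
qed

text \<open>Members of this power set contain only elements of the form \<open>a k\<close>, so
  deciding membership of these determines them.\<close>

lemma inj_on_locker_state: "inj_on (locker_state n a) (Pow (a ` {1..n}))"
proof (rule inj_onI)
  fix u v
  assume "u \<in> Pow (a ` {1..n})" "v \<in> Pow (a ` {1..n})" "locker_state n a u = locker_state n a v"
  then show "u = v"
    using locker_state_eq_imp_mem_iff[of n a u v] by blast
qed

theorem theorem3:
  fixes n :: nat and a :: "nat \<Rightarrow> 'a"
  assumes "n \<ge> 1" and "inj_on a {1..n}"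
  shows "group (sym_diff_group (a ` {1..n}))
    \<and> group (Z2_pow n)
    \<and> locker_state n a \<in> iso (sym_diff_group (a ` {1..n})) (Z2_pow n)"
proof (intro conjI)
  show "group (sym_diff_group (a ` {1..n}))"
    by (rule group_sym_diff_group)
  show "group (Z2_pow n)"
    by (simp add: Z2_pow_def)
  let ?P = "Pow (a ` {1..n})" and ?Z = "carrier (Z2_pow n)"
  have hom: "locker_state n a \<in> hom (sym_diff_group (a ` {1..n})) (Z2_pow n)"
    by (rule locker_state_hom)
  then have "locker_state n a ` ?P \<subseteq> ?Z"
    by (auto simp: hom_def sym_diff_group_def)
  moreover have "finite ?Z" "card ?Z = 2 ^ n"
    by (simp_all add: carrier_Z2_pow finite_PiE card_PiE)
  \<comment> \<open>Injectivity of \<open>a\<close> yields \<open>n\<close> distinct students, hence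
    \<open>2 ^ n\<close> subsets, and injectivity of \<open>locker_state n a\<close> keeps their
    images distinct.\<close>
  moreover have "card (locker_state n a ` ?P) = 2 ^ n"
    using assms(2) by (simp only: card_image inj_on_locker_state card_Pow finite_imageI finite_atLeastAtMost) simp
  ultimately have "locker_state n a ` ?P = ?Z"
    by (simp add: card_subset_eq)
  then have "bij_betw (locker_state n a) ?P ?Z"
    using inj_on_locker_state by (simp add: bij_betw_def)
  with hom show "locker_state n a \<in> iso (sym_diff_group (a ` {1..n})) (Z2_pow n)"
    by (simp add: iso_def sym_diff_group_def)
qed

end
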